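(* There is no non-abelian almost Hermitian proper hom-Lie algebra of dimension $2$. That is, there is no almost Hermitian hom-Lie algebra $(\mathfrak{g},[\cdot,\cdot],\phi,J,\langle\cdot,\cdot\rangle)$ with $\dim_{\mathbb{R}}\mathfrak{g}=2$, $[\cdot,\cdot]\neq 0$ and $\phi\neq\mathrm{Id}_{\mathfrak{g}}$.
   Context: All vector spaces are real. A hom-Lie algebra is a triple $(\mathfrak{g},[\cdot,\cdot],\phi)$ where $\mathfrak{g}$ is a vector space, $[\cdot,\cdot]$ is bilinear with $[u,v]=-[v,u]$, $\phi:\mathfrak{g}\to\mathfrak{g}$ is linear with $\phi([u,v])=[\phi(u),\phi(v)]$, and $[\phi(u),[v,w]]+[\phi(v),[w,u]]+[\phi(w),[u,v]]=0$ for all $u,v,w$. It is involutive if $\phi^2=\mathrm{Id}$. It is called proper if $\phi\ne\mathrm{Id}$ (i.e. it is not just a Lie algebra). An almost complex structure on an involutive hom-Lie algebra is a linear isomorphism $J$ with $J^2=-\mathrm{Id}$ and $\phi\circ J=J\circ\phi$. A pseudo-Riemannian metric on a finite-dimensional hom-Lie algebra is a symmetric non-degenerate bilinear form $\langle\cdot,\cdot\rangle$ with $\langle\phi(u),\phi(v)\rangle=\langle u,v\rangle$ for all $u,v$. An almost Hermitian structure is a pair $(J,\langle\cdot,\cdot\rangle)$ of an almost complex structure and a pseudo-Riemannian metric with $\langle(\phi\circ J)u,(\phi\circ J)v\rangle=\langle u,v\rangle$ for all $u,v$. *)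

theory Defs
  imports "HOL-Analysis.Analysis"
begin

definition hom_Lie_algebra ::
    "('a::real_vector \<Rightarrow> 'a \<Rightarrow> 'a) \<Rightarrow> ('a \<Rightarrow> 'a) \<Rightarrow> bool" where
  "hom_Lie_algebra br \<phi> \<longleftrightarrow>
     bilinear br \<and> (\<forall>u v. br u v = - br v u) \<and>
     linear \<phi> \<and> (\<forall>u v. \<phi> (br u v) = br (\<phi> u) (\<phi> v)) \<and>
     (\<forall>u v w. br (\<phi> u) (br v w) + br (\<phi> v) (br w u) + br (\<phi> w) (br u v) = 0)"

definition involutive_hom_Lie_algebra ::
    "('a::real_vector \<Rightarrow> 'a \<Rightarrow> 'a) \<Rightarrow> ('a \<Rightarrow> 'a) \<Rightarrow> bool" where
  "involutive_hom_Lie_algebra br \<phi> \<longleftrightarrow> hom_Lie_algebra br \<phi> \<and> \<phi> \<circ> \<phi> = id"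

definition proper_hom_Lie_algebra ::
    "('a::real_vector \<Rightarrow> 'a \<Rightarrow> 'a) \<Rightarrow> ('a \<Rightarrow> 'a) \<Rightarrow> bool" where
  "proper_hom_Lie_algebra br \<phi> \<longleftrightarrow> hom_Lie_algebra br \<phi> \<and> \<phi> \<noteq> id"

definition abelian_bracket :: "('a::real_vector \<Rightarrow> 'a \<Rightarrow> 'a) \<Rightarrow> bool" where
  "abelian_bracket br \<longleftrightarrow> (\<forall>u v. br u v = 0)"

definition almost_complex_structure ::
    "('a::real_vector \<Rightarrow> 'a \<Rightarrow> 'a) \<Rightarrow> ('a \<Rightarrow> 'a) \<Rightarrow> ('a \<Rightarrow> 'a) \<Rightarrow> bool" where
  "almost_complex_structure br \<phi> J \<longleftrightarrow>
     involutive_hom_Lie_algebra br \<phi> \<and>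
     linear J \<and> bij J \<and> (\<forall>u. J (J u) = - u) \<and> \<phi> \<circ> J = J \<circ> \<phi>"

definition pseudo_Riemannian_metric ::
    "('a::real_vector \<Rightarrow> 'a \<Rightarrow> 'a) \<Rightarrow> ('a \<Rightarrow> 'a) \<Rightarrow> ('a \<Rightarrow> 'a \<Rightarrow> real) \<Rightarrow> bool" where
  "pseudo_Riemannian_metric br \<phi> g \<longleftrightarrow>
     hom_Lie_algebra br \<phi> \<and> (\<exists>B::'a set. finite B \<and> span B = UNIV) \<and>
     bilinear g \<and> (\<forall>u v. g u v = g v u) \<and>
     (\<forall>u. (\<forall>v. g u v = 0) \<longrightarrow> u = 0) \<and>
     (\<forall>u v. g (\<phi> u) (\<phi> v) = g u v)"

definition almost_Hermitian_hom_Lie_algebra ::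
    "('a::real_vector \<Rightarrow> 'a \<Rightarrow> 'a) \<Rightarrow> ('a \<Rightarrow> 'a) \<Rightarrow> ('a \<Rightarrow> 'a) \<Rightarrow> ('a \<Rightarrow> 'a \<Rightarrow> real) \<Rightarrow> bool" where
  "almost_Hermitian_hom_Lie_algebra br \<phi> J g \<longleftrightarrow>
     almost_complex_structure br \<phi> J \<and> pseudo_Riemannian_metric br \<phi> g \<and>
     (\<forall>u v. g ((\<phi> \<circ> J) u) ((\<phi> \<circ> J) v) = g u v)"

end

theory Submission
  imports Defs
begin

text \<open>
  Since \<open>J\<close> commutes with \<open>\<phi>\<close>, the eigenspaces of the involution \<open>\<phi>\<close> are \<open>J\<close>-invariant, hence
  of even dimension. In dimension two this leaves only \<open>\<phi> = id\<close> and \<open>\<phi> = -id\<close>; properness rules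
  out the former. In the latter case multiplicativity of \<open>\<phi>\<close> reads \<open>-[u,v] = [-u,-v] = [u,v]\<close>,
  so the bracket vanishes.
\<close>

text \<open>
  A real eigenvalue \<open>c\<close> of \<open>J\<close> would satisfy \<open>c\<^sup>2 = -1\<close>, so no nonzero vector is collinear with its
  image under \<open>J\<close>.
\<close>
lemma complex_structure_independent_pair:
  fixes J :: "'a::real_vector \<Rightarrow> 'a"
  assumes "linear J" and J2: "\<And>u. J (J u) = - u" and "w \<noteq> 0"
  shows "independent {w, J w}" and "J w \<noteq> w"
proof -
  have not_collinear: "J w \<noteq> c *\<^sub>R w" for c
  proof
    assume c: "J w = c *\<^sub>R w"
    have "- w = J (J w)" by (simp add: J2)
    also have "\<dots> = (c * c) *\<^sub>R w"
      using \<open>linear J\<close> by (simp add: c linear_scale)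
    finally have "(c * c + 1) *\<^sub>R w = - w + w"
      by (simp only: scaleR_add_left scaleR_one)
    then have "(c * c + 1) *\<^sub>R w = 0" by simp
    then have "c * c + 1 = 0" using \<open>w \<noteq> 0\<close> by (simp only: scaleR_eq_0_iff simp_thms)
    moreover have "c * c \<ge> 0" by simp
    ultimately show False by linarith
  qed
  show "J w \<noteq> w" using not_collinear[of 1] by simp
  have "J w \<notin> span {w}" using not_collinear by (auto simp: span_singleton)
  then have "independent (insert (J w) {w})"
    using \<open>w \<noteq> 0\<close> by (intro independent_insertI) (simp_all add: independent_empty)
  then show "independent {w, J w}" by (simp add: insert_commute)
qed

lemma span_independent_card_eq_dim:
  fixes S :: "'a::real_vector set"
  assumes "independent S" and "card S = dim (UNIV :: 'a set)" and "dim (UNIV :: 'a set) > 0"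
  shows "span S = UNIV"
proof -
  define B where "B = extend_basis S"
  have B: "S \<subseteq> B" "independent B" "span B = UNIV"
    unfolding B_def
    by (rule extend_basis_superset[OF assms(1)] independent_extend_basis[OF assms(1)]
        span_extend_basis[OF assms(1)])+
  have "card B = dim (UNIV :: 'a set)"
    by (rule basis_card_eq_dim[OF subset_UNIV _ B(2)]) (simp only: B(3) order_refl)
  moreover from this have "finite B"
    using assms(3) by (intro card_ge_0_finite) (simp only:)
  ultimately have "S = B"
    using assms(2) B(1) by (intro card_subset_eq) (simp_all only:)
  with B(3) show ?thesis by (simp only:)
qed

text \<open>
  The eigenvalue \<open>-1\<close> occurs because \<open>\<phi> u - u\<close> is an eigenvector whenever it is nonzero; together
  with its image under \<open>J\<close> such an eigenvector already fills a plane.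
\<close>
lemma involution_commuting_with_complex_structure_dim_2:
  fixes \<phi> J :: "'a::real_vector \<Rightarrow> 'a"
  assumes "linear \<phi>" and inv: "\<phi> \<circ> \<phi> = id" and "linear J" and "\<And>u. J (J u) = - u"
    and comm: "\<phi> \<circ> J = J \<circ> \<phi>" and "dim (UNIV :: 'a set) = 2" and "\<phi> \<noteq> id"
  shows "\<phi> u = - u"
proof -
  obtain v where "\<phi> v \<noteq> v" using \<open>\<phi> \<noteq> id\<close> by (auto simp: fun_eq_iff)
  define w where "w = \<phi> v - v"
  have "w \<noteq> 0" using \<open>\<phi> v \<noteq> v\<close> by (simp add: w_def)
  note pair = complex_structure_independent_pair[OF \<open>linear J\<close> assms(4) this]
  have "\<phi> w = - w"
    using \<open>linear \<phi>\<close> fun_cong[OF inv, of v] by (simp add: w_def linear_diff)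
  moreover have "\<phi> (J w) = - J w"
    using fun_cong[OF comm, of w] \<open>\<phi> w = - w\<close> \<open>linear J\<close> by (simp add: linear_neg)
  moreover have "span {w, J w} = UNIV"
    using pair \<open>dim (UNIV :: 'a set) = 2\<close> by (intro span_independent_card_eq_dim) auto
  moreover have "linear (uminus :: 'a \<Rightarrow> 'a)" by (rule linearI) simp_all
  ultimately show ?thesis
    using linear_eq_on[OF \<open>linear \<phi>\<close>, of uminus u "{w, J w}"] by auto
qed

theorem corollary3p6:
  shows "\<not> (\<exists>(br :: 'a::real_vector \<Rightarrow> 'a \<Rightarrow> 'a) (\<phi> :: 'a \<Rightarrow> 'a) (J :: 'a \<Rightarrow> 'a) (g :: 'a \<Rightarrow> 'a \<Rightarrow> real).
           almost_Hermitian_hom_Lie_algebra br \<phi> J g \<and>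
           dim (UNIV :: 'a set) = 2 \<and>
           \<not> abelian_bracket br \<and>
           proper_hom_Lie_algebra br \<phi>)"
proof clarify
  fix br :: "'a \<Rightarrow> 'a \<Rightarrow> 'a" and \<phi> J :: "'a \<Rightarrow> 'a" and g :: "'a \<Rightarrow> 'a \<Rightarrow> real"
  assume "almost_Hermitian_hom_Lie_algebra br \<phi> J g" and dim: "dim (UNIV :: 'a set) = 2"
    and nonabelian: "\<not> abelian_bracket br" and "proper_hom_Lie_algebra br \<phi>"
  then have br: "bilinear br" and mult: "\<And>u v. \<phi> (br u v) = br (\<phi> u) (\<phi> v)"
    and "linear \<phi>" "\<phi> \<circ> \<phi> = id" "linear J" "\<And>u. J (J u) = - u" "\<phi> \<circ> J = J \<circ> \<phi>" "\<phi> \<noteq> id"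
    unfolding almost_Hermitian_hom_Lie_algebra_def almost_complex_structure_def
      involutive_hom_Lie_algebra_def hom_Lie_algebra_def proper_hom_Lie_algebra_def
    by blast+
  then have neg: "\<phi> u = - u" for u
    using involution_commuting_with_complex_structure_dim_2 dim by blast
  have "br u v = 0" for u v
  proof -
    have "- br u v = br u v"
      using mult[of u v] br by (simp add: neg bilinear_lneg bilinear_rneg)
    then have "2 *\<^sub>R br u v = 0" by (simp only: scaleR_2 neg_eq_iff_add_eq_0)
    then show ?thesis by simp
  qed
  with nonabelian show False by (simp add: abelian_bracket_def)
qed

end
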